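(* Let $E$ be a finite set and let $P(x)=\sum_{|\mathbf m|=r}a_{\mathbf m}x^{\mathbf m}$ be a polynomial with complex coefficients in the variables $\{x_e\}_{e\in E}$, homogeneous of degree $r$, having the half-plane property and not identically zero. Let $\operatorname{supp}(P)=\{\mathbf m: a_{\mathbf m}\neq 0\}$. Then for every $\mathbf m,\mathbf m'\in\operatorname{supp}(P)$ and every $e\in E$ with $\mathbf m(e)>\mathbf m'(e)$, there exists $f\in E$ with $\mathbf m(f)<\mathbf m'(f)$ such that $\mathbf m-\mathbf d_e+\mathbf d_f\in\operatorname{supp}(P)$.
   Context: Multi-indices are functions $\mathbf m:E\to\mathbb N$, $x^{\mathbf m}=\prod_{e}x_e^{\mathbf m(e)}$, $|\mathbf m|=\sum_e\mathbf m(e)$. For $e\in E$, $\mathbf d_e$ is the multi-index with $\mathbf d_e(e)=1$ and $\mathbf d_e(f)=0$ for $f\neq e$. A polynomial $P$ has the half-plane property if it is either identically zero or else $P(x)\neq 0$ whenever $\operatorname{Re}x_e>0$ for all $e\in E$. *)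

theory Defs
  imports Complex_Main "HOL-Library.Poly_Mapping"
begin

text \<open>Multi-indices are finitely supported functions \<open>'e \<Rightarrow>\<^sub>0 nat\<close>, and polynomials are finitely
  supported coefficient functions \<open>('e \<Rightarrow>\<^sub>0 nat) \<Rightarrow>\<^sub>0 complex\<close>, so that \<open>Poly_Mapping.keys P\<close> is the
  support of \<open>P\<close> and \<open>Poly_Mapping.single e 1\<close> is the multi-index \<open>\<^bold>d\<^sub>e\<close>. The variable set is an
  explicit set \<open>E\<close>; multi-indices on \<open>E\<close> are those vanishing outside \<open>E\<close>.\<close>

type_synonym 'e multi_index = "'e \<Rightarrow>\<^sub>0 nat"
type_synonym 'e cpoly = "'e multi_index \<Rightarrow>\<^sub>0 complex"

definition monom_eval :: "'e set \<Rightarrow> 'e multi_index \<Rightarrow> ('e \<Rightarrow> complex) \<Rightarrow> complex" where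
  "monom_eval E m x = (\<Prod>e\<in>E. x e ^ Poly_Mapping.lookup m e)"

definition mi_degree :: "'e set \<Rightarrow> 'e multi_index \<Rightarrow> nat" where
  "mi_degree E m = (\<Sum>e\<in>E. Poly_Mapping.lookup m e)"

definition supp :: "'e cpoly \<Rightarrow> 'e multi_index set" where
  "supp P = {m. Poly_Mapping.lookup P m \<noteq> 0}"

definition poly_in :: "'e set \<Rightarrow> 'e cpoly \<Rightarrow> bool" where
  "poly_in E P \<longleftrightarrow> (\<forall>m\<in>supp P. Poly_Mapping.keys m \<subseteq> E)"

definition homogeneous_of_degree :: "'e set \<Rightarrow> nat \<Rightarrow> 'e cpoly \<Rightarrow> bool" where
  "homogeneous_of_degree E r P \<longleftrightarrow> (\<forall>m\<in>supp P. mi_degree E m = r)"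

definition poly_eval :: "'e set \<Rightarrow> 'e cpoly \<Rightarrow> ('e \<Rightarrow> complex) \<Rightarrow> complex" where
  "poly_eval E P x = (\<Sum>m\<in>supp P. Poly_Mapping.lookup P m * monom_eval E m x)"

definition half_plane_property :: "'e set \<Rightarrow> 'e cpoly \<Rightarrow> bool" where
  "half_plane_property E P \<longleftrightarrow>
     P = 0 \<or> (\<forall>x. (\<forall>e\<in>E. Re (x e) > 0) \<longrightarrow> poly_eval E P x \<noteq> 0)"

end

theory Submission
  imports Defs "HOL-Complex_Analysis.Conformal_Mappings"
    "HOL-Computational_Algebra.Fundamental_Theorem_Algebra"
begin

text \<open>
  Let \<open>m\<close>, \<open>m'\<close>, \<open>e\<close> violate the exchange property, let \<open>A\<close> be the set of \<open>f\<close> with \<open>m(f) < m'(f)\<close>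
  and let \<open>B\<close> be the set of the remaining variables other than \<open>e\<close>.

  Multiplying each coefficient \<open>a\<^sub>n\<close> by \<open>n(g) - j\<close>, where \<open>j\<close> is at most the least exponent of \<open>x\<^sub>g\<close>,
  or by \<open>k - n(g)\<close>, where \<open>k\<close> is at least the largest one, preserves the half-plane property unless
  the result is zero: the quotient of the new polynomial by the old one is, up to a factor \<open>x\<^sub>g\<close> or
  \<open>1/x\<^sub>g\<close>, a holomorphic function with nonnegative real part. By iterating one may assume that all
  \<open>n\<close> in the support satisfy \<open>n \<ge> m\<close> on \<open>A\<close> and \<open>n \<le> m\<close> on \<open>B\<close>.

  Now substitute \<open>x\<^sub>v = \<lambda>\<^sub>v \<tau>\<^bsup>w(v)\<^esup>\<close>, times \<open>y\<close> if \<open>v \<in> A\<close>, with generic \<open>\<lambda> > 0\<close>. By homogeneity, the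
  resulting polynomial \<open>\<Sum> d\<^sub>l y\<^sup>l\<close> in \<open>y\<close>, with \<open>l = n(A) - m(A)\<close>, has only real nonpositive roots, so
  \<open>|d\<^sub>l| |d\<^sub>0|\<^bsup>l-1\<^esup> \<le> |d\<^sub>1|\<^sup>l\<close>. The weights \<open>w\<close> come from the edge at \<open>m\<close> of a Newton polygon, so that
  after removing a power of \<open>\<tau>\<close> only the terms on that edge survive as \<open>\<tau> \<rightarrow> 0\<close>. In the limit
  \<open>d\<^sub>0 \<noteq> 0\<close>, some other \<open>d\<^sub>l \<noteq> 0\<close>, but \<open>d\<^sub>1 = 0\<close> because no exchange is possible: a contradiction.
\<close>

section \<open>Univariate complex polynomials and the location of their roots\<close>

lemma complex_poly_root_induct [case_names const root]:
  fixes p :: "complex poly"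
  assumes const: "\<And>c. Q [:c:]" and root: "\<And>r p. p \<noteq> 0 \<Longrightarrow> Q p \<Longrightarrow> Q ([:- r, 1:] * p)"
  shows "Q p"
proof (induction "degree p" arbitrary: p)
  case 0
  then show ?case using const by (metis degree_eq_zeroE)
next
  case (Suc d)
  then have "\<not> constant (poly p)" by (simp add: constant_degree)
  then obtain r where "poly p r = 0" using fundamental_theorem_of_algebra by blast
  then obtain q where q: "p = [:- r, 1:] * q" by (auto simp: poly_eq_0_iff_dvd elim: dvdE)
  have "q \<noteq> 0" using q Suc.hyps(2) by auto
  then have "degree p = Suc (degree q)" unfolding q by (subst degree_mult_eq) auto
  then show ?case using Suc q root \<open>q \<noteq> 0\<close> by simp
qed

lemma pderiv_linear_mult: "pderiv ([:- r, 1:] * p) = p + [:- r, 1:] * pderiv p"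
  for p :: "complex poly"
  unfolding pderiv_mult by (simp add: pderiv_pCons)

text \<open>The logarithmic derivative is the sum of \<open>1 / (z - r)\<close> over the roots
  \<open>r\<close>. No root lies in the open right half-plane, so every summand has nonnegative real
  part.\<close>

lemma Re_logderiv_nonneg:
  fixes p :: "complex poly"
  assumes "\<And>z. Re z > 0 \<Longrightarrow> poly p z \<noteq> 0" and "Re z > 0"
  shows "Re (poly (pderiv p) z / poly p z) \<ge> 0"
  using assms(1)
proof (induction p rule: complex_poly_root_induct)
  case (const c)
  then show ?case by (simp add: pderiv_pCons)
next
  case (root r p)
  have nz: "poly p w \<noteq> 0" "w \<noteq> r" if "Re w > 0" for w
    using root.prems[OF that] by auto
  have "Re r \<le> 0" using nz(2)[of r] by force
  then have "Re (1 / (z - r)) \<ge> 0"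
    using assms(2) by (simp add: Re_divide)
  moreover have "poly (pderiv ([:- r, 1:] * p)) z / poly ([:- r, 1:] * p) z
      = 1 / (z - r) + poly (pderiv p) z / poly p z"
    using nz[OF assms(2)] by (simp only: pderiv_linear_mult) (simp add: field_simps)
  ultimately show ?case using root.IH nz(1) by simp
qed

text \<open>The expression is the logarithmic derivative of the reversed polynomial
  \<open>w^N p(1/w)\<close> at \<open>w = 1/z\<close>. Each root \<open>r\<close> contributes
  \<open>- r * z / (z - r)\<close>, each unit of \<open>N\<close> beyond the degree contributes
  \<open>z\<close>.\<close>

lemma Re_reverse_logderiv_nonneg:
  fixes p :: "complex poly"
  assumes "\<And>z. Re z > 0 \<Longrightarrow> poly p z \<noteq> 0" and "Re z > 0" and "degree p \<le> N"
  shows "Re (z * (of_nat N * poly p z - z * poly (pderiv p) z) / poly p z) \<ge> 0"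
  using assms(1,3)
proof (induction p arbitrary: N rule: complex_poly_root_induct)
  case (const c)
  then have "c \<noteq> 0" using assms(2) by force
  then show ?case using assms(2) by (simp add: pderiv_pCons)
next
  case (root r p)
  have nz: "poly p w \<noteq> 0" "w \<noteq> r" if "Re w > 0" for w
    using root.prems(1)[OF that] by auto
  have r: "Re r \<le> 0" using nz(2)[of r] by force
  have "p \<noteq> 0" using nz(1)[OF assms(2)] by auto
  then have deg: "degree ([:-r, 1:] * p) = Suc (degree p)" by (subst degree_mult_eq) auto
  then obtain M where M: "N = Suc M" "degree p \<le> M" using root.prems(2) by (cases N) auto
  \<comment> \<open>For nonzero \<open>r\<close> the term is the reciprocal of
    \<open>1 / (- r) + 1 / z\<close>, and inversion preserves nonnegative real parts.\<close>
  have *: "Re (- r * z / (z - r)) \<ge> 0"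
  proof (cases "r = 0")
    case False
    have "z \<noteq> 0" using assms(2) by auto
    have inv: "Re (1 / w) \<ge> 0" if "Re w \<ge> 0" for w using that by (simp add: Re_divide)
    have "Re (1 / (- r)) \<ge> 0" "Re (1 / z) \<ge> 0" using r assms(2) by (auto intro!: inv simp del: divide_minus_right)
    then have "Re (1 / (1 / (- r) + 1 / z)) \<ge> 0" by (intro inv) simp
    also have "1 / (1 / (- r) + 1 / z) = - r * z / (z - r)"
      using False \<open>z \<noteq> 0\<close> nz(2)[OF assms(2)] by (simp add: divide_simps) (simp add: algebra_simps)
    finally show ?thesis .
  qed simp
  have "z * (of_nat N * poly ([:- r, 1:] * p) z - z * poly (pderiv ([:- r, 1:] * p)) z) / poly ([:- r, 1:] * p) z
      = - r * z / (z - r) + z * (of_nat M * poly p z - z * poly (pderiv p) z) / poly p z"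
    using nz[OF assms(2)] M(1)
    by (simp only: pderiv_linear_mult) (simp add: divide_simps, simp add: algebra_simps)
  then show ?case using root.IH[OF nz(1) M(2)] * by simp
qed

text \<open>Divided by its constant term, \<open>p\<close> is a product of factors
  \<open>1 + \<beta> y\<close> with \<open>\<beta> > 0\<close>. Its coefficients \<open>b l\<close>
  are then elementary symmetric functions of the \<open>\<beta>\<close>, bounded by powers of their
  sum \<open>b 1\<close>.\<close>

lemma coeff_bound_nonpos_real_roots:
  fixes p :: "complex poly"
  assumes "coeff p 0 \<noteq> 0" and "\<And>z. poly p z = 0 \<Longrightarrow> z \<in> \<real>\<^sub>\<le>\<^sub>0"
  shows "norm (coeff p (Suc l)) * norm (coeff p 0) ^ l \<le> norm (coeff p 1) ^ Suc l"
proof -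
  have "\<exists>b. (\<forall>l. coeff p l = coeff p 0 * of_real (b l) \<and> 0 \<le> b l \<and> b l \<le> b 1 ^ l)"
    using assms
  proof (induction p rule: complex_poly_root_induct)
    case (const c)
    show ?case
      by (intro exI[of _ "\<lambda>l. if l = 0 then 1 else 0"]) (auto simp: coeff_pCons split: nat.split)
  next
    case (root r p)
    have "r \<in> \<real>\<^sub>\<le>\<^sub>0" using root.prems(2)[of r] by simp
    then obtain s where s: "r = of_real s" "s \<le> 0" by (auto elim!: nonpos_Reals_cases)
    have p0: "r \<noteq> 0" "coeff p 0 \<noteq> 0" using root.prems(1) by (auto simp: coeff_mult)
    obtain b where b: "\<And>l. coeff p l = coeff p 0 * of_real (b l)" "\<And>l. 0 \<le> b l" "\<And>l. b l \<le> b 1 ^ l"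
      using root.IH p0(2) root.prems(2) by auto
    have "s < 0" using s p0 by auto
    define \<beta> where "\<beta> = - 1 / s"
    have \<beta>: "\<beta> > 0" using \<open>s < 0\<close> by (simp add: \<beta>_def divide_simps)
    have b0: "b 0 = 1" using b(1)[of 0] p0 by simp
    define b' where "b' l = (case l of 0 \<Rightarrow> 1 | Suc k \<Rightarrow> b (Suc k) + \<beta> * b k)" for l
    have "coeff ([:- r, 1:] * p) l = coeff ([:- r, 1:] * p) 0 * of_real (b' l)" for l
    proof (cases l)
      case (Suc k)
      have "coeff ([:- r, 1:] * p) l = coeff p 0 * (of_real (b k) - r * of_real (b (Suc k)))"
        using Suc b(1)[of k] b(1)[of "Suc k"] by (simp add: algebra_simps)
      also have "\<dots> = coeff ([:- r, 1:] * p) 0 * of_real (b' l)"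
        using Suc \<open>s < 0\<close> by (simp add: b'_def s \<beta>_def algebra_simps)
      finally show ?thesis .
    qed (simp add: b'_def)
    moreover have "0 \<le> b' l" for l using b(2) \<beta> by (cases l) (auto simp: b'_def)
    moreover have "b' l \<le> b' 1 ^ l" for l
    proof (cases l)
      case (Suc k)
      have "b' l \<le> b 1 ^ Suc k + \<beta> * b 1 ^ k"
        using b(3)[of "Suc k"] b(3)[of k] \<beta> Suc by (auto simp: b'_def intro!: add_mono mult_left_mono)
      also have "\<dots> = (b 1 + \<beta>) * b 1 ^ k" by (simp add: algebra_simps)
      also have "\<dots> \<le> (b 1 + \<beta>) * (b 1 + \<beta>) ^ k"
        using b(2)[of 1] \<beta> by (intro mult_left_mono power_mono) auto
      finally show ?thesis using Suc b0 by (simp add: b'_def)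
    qed (simp add: b'_def)
    ultimately show ?case by blast
  qed
  then obtain b where b: "\<And>l. coeff p l = coeff p 0 * of_real (b l)" "\<And>l. 0 \<le> b l" "\<And>l. b l \<le> b 1 ^ l"
    by blast
  have n: "norm (coeff p l) = norm (coeff p 0) * b l" for l
    using b(2)[of l] by (subst b(1)) (simp add: norm_mult)
  have "norm (coeff p (Suc l)) * norm (coeff p 0) ^ l = norm (coeff p 0) ^ Suc l * b (Suc l)"
    by (subst n) simp
  also have "\<dots> \<le> norm (coeff p 0) ^ Suc l * b 1 ^ Suc l"
    by (intro mult_left_mono b(3)) auto
  also have "\<dots> = norm (coeff p 1) ^ Suc l" by (subst n[of 1]) (simp add: power_mult_distrib)
  finally show ?thesis .
qed

section \<open>Supports of polynomials without zeros in the right half-planes\<close>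

definition msum :: "'e set \<Rightarrow> 'e multi_index set \<Rightarrow> ('e multi_index \<Rightarrow> complex) \<Rightarrow> ('e \<Rightarrow> complex) \<Rightarrow> complex" where
  "msum E T c x = (\<Sum>n\<in>T. c n * monom_eval E n x)"

text \<open>The coefficients are existentially quantified because truncation rescales them, while
  the exchange argument concerns only the support.\<close>

definition hp_support :: "'e set \<Rightarrow> 'e multi_index set \<Rightarrow> bool" where
  "hp_support E T \<longleftrightarrow> finite T \<and> (\<forall>n\<in>T. Poly_Mapping.keys n \<subseteq> E) \<and>
     (\<exists>c. (\<forall>n\<in>T. c n \<noteq> 0) \<and> (\<forall>x. (\<forall>e\<in>E. Re (x e) > 0) \<longrightarrow> msum E T c x \<noteq> 0))"

definition slice_poly :: "'e set \<Rightarrow> 'e \<Rightarrow> 'e multi_index set \<Rightarrow> ('e multi_index \<Rightarrow> complex) \<Rightarrow>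
    ('e \<Rightarrow> complex) \<Rightarrow> complex poly" where
  "slice_poly E g T c x = (\<Sum>n\<in>T. monom (c n * monom_eval (E - {g}) n x) (Poly_Mapping.lookup n g))"

lemma monom_eval_upd:
  assumes "finite E" "g \<in> E"
  shows "monom_eval E n (x(g := z)) = z ^ Poly_Mapping.lookup n g * monom_eval (E - {g}) n x"
  unfolding monom_eval_def using assms by (subst prod.remove[of E g]) (auto intro!: prod.cong)

lemma poly_slice_poly:
  assumes "finite E" "g \<in> E"
  shows "poly (slice_poly E g T c x) z = msum E T c (x(g := z))"
  unfolding slice_poly_def msum_def
  by (simp add: poly_sum poly_monom monom_eval_upd[OF assms] mult_ac)

text \<open>The Euler operator is diagonal on monomials; this turns coefficient weights into
  logarithmic derivatives.\<close>

lemma poly_pderiv_slice_poly: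
  assumes "finite E" "g \<in> E"
  shows "z * poly (pderiv (slice_poly E g T c x)) z
    = msum E T (\<lambda>n. of_nat (Poly_Mapping.lookup n g) * c n) (x(g := z))"
proof -
  have *: "z * poly (pderiv (monom a k)) z = of_nat k * (a * z ^ k)" for k and a :: complex
    by (cases k) (auto simp: pderiv_monom poly_monom)
  have "pderiv (slice_poly E g T c x)
      = (\<Sum>n\<in>T. pderiv (monom (c n * monom_eval (E - {g}) n x) (Poly_Mapping.lookup n g)))"
    unfolding slice_poly_def using higher_pderiv_sum[of 1] by simp
  then show ?thesis
    unfolding msum_def by (simp add: poly_sum sum_distrib_left * monom_eval_upd[OF assms] mult_ac)
qed

text \<open>Induction on the support: keep the terms with one fixed exponent of a variable
  separating two members. A point good for these makes the polynomial in that variable nonzero, and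
  the variable is then moved off its finitely many roots.\<close>

lemma exists_positive_nonzero:
  assumes "finite E" "finite T" "T \<noteq> {}" "\<forall>n\<in>T. Poly_Mapping.keys n \<subseteq> E" "\<forall>n\<in>T. c n \<noteq> 0"
  shows "\<exists>l. (\<forall>e. l e > 0) \<and> msum E T c (\<lambda>e. complex_of_real (l e)) \<noteq> 0"
  using assms(2-)
proof (induction T rule: finite_psubset_induct)
  case (psubset T)
  show ?case
  proof (cases "\<exists>m. T = {m}")
    case True
    then show ?thesis
      using psubset.prems by (intro exI[of _ "\<lambda>_. 1"]) (auto simp: msum_def monom_eval_def)
  next
    case False
    then obtain m m' where m: "m \<in> T" "m' \<in> T" "m \<noteq> m'" using psubset.prems(1) by blast
    then obtain e where e: "Poly_Mapping.lookup m e \<noteq> Poly_Mapping.lookup m' e"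
      by (meson poly_mapping_eqI)
    then have "e \<in> E" using m psubset.prems(2) by (metis in_keys_iff subsetD)
    define K where "K = Poly_Mapping.lookup m e"
    define T' where "T' = {n\<in>T. Poly_Mapping.lookup n e = K}"
    have "m \<in> T'" "m' \<in> T - T'" "T' \<subseteq> T" using e m by (auto simp: T'_def K_def)
    then have "T' \<subset> T" "T' \<noteq> {}" by auto
    then obtain l where l: "\<forall>e. l e > 0" "msum E T' c (\<lambda>e. complex_of_real (l e)) \<noteq> 0"
      using psubset.IH[of T'] psubset.prems by (auto simp: T'_def)
    define x where "x = (\<lambda>e. complex_of_real (l e))"
    define p where "p = slice_poly E e T c x"
    have "coeff p K = (\<Sum>n\<in>T'. c n * monom_eval (E - {e}) n x)"
      unfolding p_def slice_poly_def T'_def using psubset.hyps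
      by (simp add: coeff_sum sum.inter_filter)
    moreover have "msum E T' c x = x e ^ K * (\<Sum>n\<in>T'. c n * monom_eval (E - {e}) n x)"
      using monom_eval_upd[OF assms(1) \<open>e \<in> E\<close>, of _ x "x e"]
      by (auto simp: msum_def T'_def sum_distrib_left intro!: sum.cong)
    ultimately have "p \<noteq> 0" using l(2) by (auto simp: x_def)
    then have "finite {z. poly p z = 0}" by (rule poly_roots_finite)
    moreover have "infinite (complex_of_real ` {0<..})"
      by (subst finite_image_iff) (auto simp: inj_on_def infinite_Ioi)
    ultimately obtain s where s: "s > 0" "poly p (complex_of_real s) \<noteq> 0"
      by (metis (mono_tags, lifting) finite_subset greaterThan_iff image_subset_iff mem_Collect_eq)
    have "(\<lambda>v. complex_of_real ((l(e := s)) v)) = x(e := of_real s)" by (auto simp: x_def)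
    then show ?thesis using s l(1) poly_slice_poly[OF assms(1) \<open>e \<in> E\<close>, of T c x "of_real s"]
      by (intro exI[of _ "l(e := s)"]) (auto simp: p_def)
  qed
qed

text \<open>A holomorphic function with nonnegative real part that vanishes somewhere is identically zero,
  so along complex lines the modified polynomial cannot acquire a zero.\<close>

lemma hp_support_multiplier:
  assumes E: "finite E" "g \<in> E" and T: "finite T" "\<forall>n\<in>T. Poly_Mapping.keys n \<subseteq> E"
    and c: "\<forall>n\<in>T. c n \<noteq> 0" "\<And>x. \<forall>e\<in>E. Re (x e) > 0 \<Longrightarrow> msum E T c x \<noteq> 0"
    and ne: "{n\<in>T. \<omega> n \<noteq> 0} \<noteq> {}"
    and \<kappa>: "\<kappa> holomorphic_on {z. Re z > 0}" "\<And>z. Re z > 0 \<Longrightarrow> \<kappa> z \<noteq> 0"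
    and nonneg: "\<And>x. \<forall>e\<in>E. Re (x e) > 0 \<Longrightarrow>
      Re (\<kappa> (x g) * msum E T (\<lambda>n. \<omega> n * c n) x / msum E T c x) \<ge> 0"
  shows "hp_support E {n\<in>T. \<omega> n \<noteq> 0}"
proof -
  define c' where "c' n = \<omega> n * c n" for n
  define T' where "T' = {n\<in>T. \<omega> n \<noteq> 0}"
  have T': "finite T'" "T' \<noteq> {}" "\<forall>n\<in>T'. Poly_Mapping.keys n \<subseteq> E" "\<forall>n\<in>T'. c' n \<noteq> 0"
    using T c ne by (auto simp: T'_def c'_def)
  have msum_eq: "msum E T' c' x = msum E T c' x" for x
    unfolding msum_def using T by (intro sum.mono_neutral_left) (auto simp: T'_def c'_def)
  have "msum E T' c' x0 \<noteq> 0" if x0: "\<forall>e\<in>E. Re (x0 e) > 0" for x0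
  proof
    assume zero: "msum E T' c' x0 = 0"
    obtain l where l: "\<forall>e. l e > 0" "msum E T' c' (\<lambda>e. complex_of_real (l e)) \<noteq> 0"
      using exists_positive_nonzero[OF E(1) T'] by blast
    define x1 where "x1 = (\<lambda>e. complex_of_real (l e))"
    \<comment> \<open>The line joins the supposed zero \<open>x0\<close>, at 0, to the positive
      point \<open>x1\<close>, at 1. Since \<open>h\<close> differs at these two parameters, it is
      not constant.\<close>
    define L where "L \<zeta> = (\<lambda>v. x0 v + \<zeta> * (x1 v - x0 v))" for \<zeta>
    define S where "S = {\<zeta>. \<forall>e\<in>E. Re (L \<zeta> e) > 0}"
    define h where "h \<zeta> = \<kappa> (L \<zeta> g) * msum E T c' (L \<zeta>) / msum E T c (L \<zeta>)" for \<zeta>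
    have S_eq: "S = (\<Inter>e\<in>E. {\<zeta>. Re (L \<zeta> e) > 0})" by (auto simp: S_def)
    have "open S" unfolding S_eq L_def
      by (intro open_INT E(1) ballI open_Collect_less continuous_intros)
    have "convex S" unfolding S_eq
    proof (intro convex_INT convexI)
      fix e \<zeta> \<eta> and u v :: real
      assume *: "\<zeta> \<in> {\<zeta>. Re (L \<zeta> e) > 0}" "\<eta> \<in> {\<zeta>. Re (L \<zeta> e) > 0}" "0 \<le> u" "0 \<le> v" "u + v = 1"
      then have v: "v = 1 - u" by simp
      have "L (u *\<^sub>R \<zeta> + v *\<^sub>R \<eta>) e = u *\<^sub>R L \<zeta> e + v *\<^sub>R L \<eta> e"
        unfolding v L_def by (simp add: scaleR_conv_of_real algebra_simps)
      moreover have "u * Re (L \<zeta> e) + v * Re (L \<eta> e) > 0"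
        using * by (cases "u = 0") (auto intro!: add_pos_nonneg)
      ultimately show "u *\<^sub>R \<zeta> + v *\<^sub>R \<eta> \<in> {\<zeta>. Re (L \<zeta> e) > 0}" by simp
    qed
    have L01: "L 0 = x0" "L 1 = x1" by (auto simp: L_def)
    have "0 \<in> S" "1 \<in> S" using x0 l by (auto simp: S_def L01 x1_def)
    have holL: "(\<lambda>\<zeta>. msum E T a (L \<zeta>)) holomorphic_on S" for a
      unfolding msum_def monom_eval_def L_def by (intro holomorphic_intros)
    have "(\<lambda>\<zeta>. L \<zeta> g) holomorphic_on S" unfolding L_def by (intro holomorphic_intros)
    then have "(\<lambda>\<zeta>. \<kappa> (L \<zeta> g)) holomorphic_on S"
      using holomorphic_on_compose_gen[OF _ \<kappa>(1), of "\<lambda>\<zeta>. L \<zeta> g" S] E(2)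
      by (auto simp: S_def o_def)
    then have holh: "h holomorphic_on S"
      unfolding h_def using c(2) by (intro holomorphic_intros holL) (auto simp: S_def)
    have h0: "h 0 = 0" using zero by (simp add: h_def L01 msum_eq)
    have h1: "h 1 \<noteq> 0" using l c(2)[of x1] \<kappa>(2)[of "x1 g"] E(2) by (auto simp: h_def L01 x1_def msum_eq)
    have "\<not> h constant_on S"
      using h0 h1 \<open>0 \<in> S\<close> \<open>1 \<in> S\<close> unfolding constant_on_def by metis
    then have "open (h ` S)"
      using open_mapping_thm[OF holh \<open>open S\<close> convex_connected[OF \<open>convex S\<close>] \<open>open S\<close>] by blast
    moreover have "0 \<in> h ` S" using h0 \<open>0 \<in> S\<close> by force
    ultimately obtain \<epsilon> where \<epsilon>: "\<epsilon> > 0" "ball 0 \<epsilon> \<subseteq> h ` S" by (auto simp: open_contains_ball)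
    have "complex_of_real (- \<epsilon> / 2) \<in> ball 0 \<epsilon>" using \<epsilon>(1) by (simp add: norm_divide)
    then obtain \<zeta> where "\<zeta> \<in> S" "h \<zeta> = complex_of_real (- \<epsilon> / 2)"
      using \<epsilon>(2) by (metis imageE subsetD)
    moreover have "Re (h \<zeta>) \<ge> 0" if "\<zeta> \<in> S" for \<zeta>
      using nonneg[of "L \<zeta>"] that by (simp add: h_def c'_def[abs_def] S_def)
    ultimately show False using \<epsilon>(1) by force
  qed
  then show ?thesis using T' unfolding hp_support_def T'_def[symmetric] by blast
qed

section \<open>Truncation of supports by bounds on exponents\<close>

text \<open>The weight \<open>n(g) - j\<close> deletes exactly the exponent \<open>j\<close>. If the
  slice is \<open>z^j q\<close>, the weighted slice is \<open>z^(j+1) q'\<close>, so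
  \<open>\<kappa> = 1/z\<close> leaves the logarithmic derivative of \<open>q\<close>.\<close>

lemma hp_support_above:
  assumes E: "finite E" "g \<in> E" and "hp_support E T" and "m \<in> T" and "k \<le> Poly_Mapping.lookup m g"
  shows "hp_support E {n\<in>T. k \<le> Poly_Mapping.lookup n g}"
  using assms(5)
proof (induction k)
  case 0
  then show ?case using assms(3) by simp
next
  case (Suc j)
  define U where "U = {n\<in>T. j \<le> Poly_Mapping.lookup n g}"
  have "hp_support E U" using Suc by (simp add: U_def)
  then obtain c where U: "finite U" "\<forall>n\<in>U. Poly_Mapping.keys n \<subseteq> E" "\<forall>n\<in>U. c n \<noteq> 0"
    and hp: "\<And>x. \<forall>e\<in>E. Re (x e) > 0 \<Longrightarrow> msum E U c x \<noteq> 0" unfolding hp_support_def by blast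
  define \<omega> :: "_ \<Rightarrow> complex" where "\<omega> n = of_nat (Poly_Mapping.lookup n g) - of_nat j" for n
  have eq: "{n\<in>U. \<omega> n \<noteq> 0} = {n\<in>T. Suc j \<le> Poly_Mapping.lookup n g}"
    by (auto simp: U_def \<omega>_def)
  have "hp_support E {n\<in>U. \<omega> n \<noteq> 0}"
  proof (rule hp_support_multiplier[where \<kappa> = "\<lambda>z. 1 / z" and c = c])
    show "{n\<in>U. \<omega> n \<noteq> 0} \<noteq> {}" using assms(4) Suc.prems unfolding eq by auto
  next
    fix x assume x: "\<forall>e\<in>E. Re (x e) > 0"
    define p where "p = slice_poly E g U c x"
    define z where "z = x g"
    have z: "Re z > 0" "z \<noteq> 0" "x(g := z) = x" using x E by (auto simp: z_def)
    have "monom 1 j dvd p"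
      unfolding monom_1_dvd_iff' p_def slice_poly_def by (auto simp: coeff_sum U_def intro!: sum.neutral)
    then obtain q where q: "p = monom 1 j * q" by (elim dvdE)
    have "poly p w \<noteq> 0" if "Re w > 0" for w
      unfolding p_def poly_slice_poly[OF E] by (rule hp) (use x that in auto)
    then have "Re (poly (pderiv q) z / poly q z) \<ge> 0" "poly q z \<noteq> 0"
      using z by (auto intro!: Re_logderiv_nonneg simp: q)
    moreover have "msum E U (\<lambda>n. \<omega> n * c n) x = z * poly (pderiv p) z - of_nat j * poly p z"
      unfolding p_def poly_pderiv_slice_poly[OF E] poly_slice_poly[OF E] z(3)
      by (simp add: msum_def \<omega>_def algebra_simps sum_subtractf sum_distrib_left)
    moreover have "msum E U c x = poly p z" unfolding p_def poly_slice_poly[OF E] z(3) ..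
    moreover have "z * poly (pderiv p) z - of_nat j * poly p z = z ^ Suc j * poly (pderiv q) z"
      unfolding q by (cases j) (auto simp: pderiv_mult pderiv_monom poly_monom algebra_simps)
    moreover have "poly p z = z ^ j * poly q z" by (simp add: q poly_monom)
    ultimately show "Re (1 / x g * msum E U (\<lambda>n. \<omega> n * c n) x / msum E U c x) \<ge> 0"
      using z(2) by (simp add: z_def[symmetric])
  qed (use E U hp in \<open>auto intro!: holomorphic_intros\<close>)
  then show ?case unfolding eq .
qed

text \<open>The weight \<open>N - n(g)\<close> deletes the exponent \<open>N\<close>; with
  \<open>\<kappa> = z\<close> the quotient is the reversed logarithmic derivative.\<close>

lemma hp_support_below_step:
  assumes E: "finite E" "g \<in> E" and "hp_support E U" and "m \<in> U" and "Poly_Mapping.lookup m g < N"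
    and le: "\<forall>n\<in>U. Poly_Mapping.lookup n g \<le> N"
  shows "hp_support E {n\<in>U. Poly_Mapping.lookup n g < N}"
proof -
  obtain c where U: "finite U" "\<forall>n\<in>U. Poly_Mapping.keys n \<subseteq> E" "\<forall>n\<in>U. c n \<noteq> 0"
    and hp: "\<And>x. \<forall>e\<in>E. Re (x e) > 0 \<Longrightarrow> msum E U c x \<noteq> 0" using assms(3) unfolding hp_support_def by blast
  define \<omega> :: "_ \<Rightarrow> complex" where "\<omega> n = of_nat N - of_nat (Poly_Mapping.lookup n g)" for n
  have eq: "{n\<in>U. \<omega> n \<noteq> 0} = {n\<in>U. Poly_Mapping.lookup n g < N}"
    using le by (auto simp: \<omega>_def order.strict_iff_order)
  have "hp_support E {n\<in>U. \<omega> n \<noteq> 0}"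
  proof (rule hp_support_multiplier[where \<kappa> = "\<lambda>z. z" and c = c])
    show "{n\<in>U. \<omega> n \<noteq> 0} \<noteq> {}" using assms(4,5) unfolding eq by auto
  next
    fix x assume x: "\<forall>e\<in>E. Re (x e) > 0"
    define p where "p = slice_poly E g U c x"
    define z where "z = x g"
    have z: "Re z > 0" "x(g := z) = x" using x E by (auto simp: z_def)
    have "degree p \<le> N"
      unfolding p_def slice_poly_def using le U(1)
      by (intro degree_sum_le) (auto intro: order_trans[OF degree_monom_le])
    moreover have "poly p w \<noteq> 0" if "Re w > 0" for w
      unfolding p_def poly_slice_poly[OF E] by (rule hp) (use x that in auto)
    ultimately have "Re (z * (of_nat N * poly p z - z * poly (pderiv p) z) / poly p z) \<ge> 0"
      using z by (intro Re_reverse_logderiv_nonneg) auto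
    moreover have "msum E U (\<lambda>n. \<omega> n * c n) x = of_nat N * poly p z - z * poly (pderiv p) z"
      unfolding p_def poly_pderiv_slice_poly[OF E] poly_slice_poly[OF E] z(2)
      by (simp add: msum_def \<omega>_def algebra_simps sum_subtractf sum_distrib_left)
    moreover have "msum E U c x = poly p z" unfolding p_def poly_slice_poly[OF E] z(2) ..
    ultimately show "Re (x g * msum E U (\<lambda>n. \<omega> n * c n) x / msum E U c x) \<ge> 0"
      by (simp add: z_def[symmetric])
  qed (use E U hp in \<open>auto intro!: holomorphic_intros\<close>)
  then show ?thesis unfolding eq .
qed

lemma hp_support_below:
  assumes E: "finite E" "g \<in> E" and "hp_support E T" and "m \<in> T"
  shows "hp_support E {n\<in>T. Poly_Mapping.lookup n g \<le> Poly_Mapping.lookup m g}"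
proof -
  have "finite T" using assms(3) by (simp add: hp_support_def)
  define M where "M = Max ((\<lambda>n. Poly_Mapping.lookup n g) ` T)"
  have M: "Poly_Mapping.lookup n g \<le> M" if "n \<in> T" for n
    unfolding M_def using \<open>finite T\<close> that by auto
  have "Poly_Mapping.lookup m g \<le> M" using M assms(4) .
  \<comment> \<open>The bound descends from the largest exponent \<open>M\<close> one unit at a
    time; \<open>m\<close> survives each cut.\<close>
  then show ?thesis
  proof (induction rule: inc_induct)
    case base
    have "{n\<in>T. Poly_Mapping.lookup n g \<le> M} = T" using M by auto
    then show ?case using assms(3) by simp
  next
    case (step k)
    have "hp_support E {n \<in> {n\<in>T. Poly_Mapping.lookup n g \<le> Suc k}. Poly_Mapping.lookup n g < Suc k}"
      using step assms(4) by (intro hp_support_below_step[OF E step.IH, of m]) auto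
    also have "{n \<in> {n\<in>T. Poly_Mapping.lookup n g \<le> Suc k}. Poly_Mapping.lookup n g < Suc k}
       = {n\<in>T. Poly_Mapping.lookup n g \<le> k}" by auto
    finally show ?case .
  qed
qed

lemma hp_support_box:
  assumes E: "finite E" and "A \<subseteq> E" "B \<subseteq> E" and T: "hp_support E T" "m \<in> T"
  shows "hp_support E {n\<in>T. (\<forall>f\<in>A. Poly_Mapping.lookup m f \<le> Poly_Mapping.lookup n f) \<and>
     (\<forall>g\<in>B. Poly_Mapping.lookup n g \<le> Poly_Mapping.lookup m g)}"
proof -
  let ?TA = "\<lambda>A. {n\<in>T. \<forall>f\<in>A. Poly_Mapping.lookup m f \<le> Poly_Mapping.lookup n f}"
  have "finite A" "finite B" using assms finite_subset by blast+
  from this(1) \<open>A \<subseteq> E\<close> have A: "hp_support E (?TA A)"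
  proof (induction A)
    case (insert g A)
    have "?TA (insert g A) = {n\<in>?TA A. Poly_Mapping.lookup m g \<le> Poly_Mapping.lookup n g}" by auto
    then show ?case using hp_support_above[OF E, of g "?TA A" m] insert T(2) by simp
  qed (use T in simp)
  let ?TB = "\<lambda>B. {n\<in>?TA A. \<forall>g\<in>B. Poly_Mapping.lookup n g \<le> Poly_Mapping.lookup m g}"
  from \<open>finite B\<close> \<open>B \<subseteq> E\<close> have "hp_support E (?TB B)"
  proof (induction B)
    case (insert g B)
    have "?TB (insert g B) = {n\<in>?TB B. Poly_Mapping.lookup n g \<le> Poly_Mapping.lookup m g}" by auto
    then show ?case using hp_support_below[OF E, of g "?TB B" m] insert T(2) by simp
  qed (use A in simp)
  then show ?thesis by (simp add: conj_assoc)
qed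

section \<open>Homogeneity and the exchange property\<close>

lemma msum_scale:
  assumes "\<forall>n\<in>T. mi_degree E n = r"
  shows "msum E T c (\<lambda>v. s * x v) = s ^ r * msum E T c x"
  using assms unfolding msum_def sum_distrib_left
  by (intro sum.cong)
    (auto simp: monom_eval_def mi_degree_def power_mult_distrib prod.distrib power_sum mult_ac)

lemma Re_csqrt_pos:
  assumes "y \<notin> \<real>\<^sub>\<le>\<^sub>0"
  shows "Re (csqrt y) > 0"
proof (rule ccontr)
  assume "\<not> Re (csqrt y) > 0"
  then have "Re (csqrt y) = 0" using Re_csqrt[of y] by simp
  then have "y = of_real (- (Im (csqrt y))\<^sup>2)"
    by (subst power2_csqrt[of y, symmetric]) (simp add: complex_eq_iff power2_eq_square)
  then show False using assms by (metis neg_le_0_iff_le nonpos_Reals_of_real_iff zero_le_power2)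
qed

lemma hp_support_exchange:
  fixes E :: "'e set"
  assumes E: "finite E" and T: "hp_support E T" and homog: "\<forall>n\<in>T. mi_degree E n = r"
    and m: "m \<in> T" "m' \<in> T" and e: "e \<in> E" "Poly_Mapping.lookup m' e < Poly_Mapping.lookup m e"
  shows "\<exists>f\<in>E. Poly_Mapping.lookup m f < Poly_Mapping.lookup m' f \<and>
     m - Poly_Mapping.single e 1 + Poly_Mapping.single f 1 \<in> T"
proof (rule ccontr)
  assume no_exchange: "\<not> ?thesis"
  let ?L = Poly_Mapping.lookup
  define A where "A = {f\<in>E. ?L m f < ?L m' f}"
  define B where "B = E - A - {e}"
  define U where "U = {n\<in>T. (\<forall>f\<in>A. ?L m f \<le> ?L n f) \<and> (\<forall>g\<in>B. ?L n g \<le> ?L m g)}"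
  have AB: "A \<subseteq> E" "B \<subseteq> E" "finite A" "finite B" "E = insert e (A \<union> B)" "A \<inter> B = {}" "e \<notin> A" "e \<notin> B"
    using E e by (auto simp: A_def B_def)
  have "hp_support E U" unfolding U_def by (rule hp_support_box[OF E AB(1,2) T m(1)])
  then obtain c where U: "finite U" "\<forall>n\<in>U. Poly_Mapping.keys n \<subseteq> E" and c: "\<forall>n\<in>U. c n \<noteq> 0"
    and hp: "\<And>x. \<forall>e\<in>E. Re (x e) > 0 \<Longrightarrow> msum E U c x \<noteq> 0" unfolding hp_support_def by blast
  have mU: "m \<in> U" "m' \<in> U" using m by (auto simp: U_def A_def B_def)
  \<comment> \<open>By homogeneity \<open>J n\<close> and \<open>K n\<close> determine
    \<open>n(e)\<close>, so the terms can be studied in the plane.\<close>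
  define J where "J n = (\<Sum>f\<in>A. ?L n f)" for n :: "'e multi_index"
  define K where "K n = (\<Sum>g\<in>B. ?L n g)" for n :: "'e multi_index"
  have split_E: "(\<Sum>v\<in>E. h v) = h e + (\<Sum>v\<in>A. h v) + (\<Sum>v\<in>B. h v)" for h :: "'e \<Rightarrow> nat"
    unfolding AB(5) using AB(3,4,6-8) by (simp add: sum.union_disjoint)
  have deg: "?L n e + J n + K n = r" if "n \<in> U" for n
    using homog that split_E[of "?L n"] by (auto simp: U_def mi_degree_def J_def K_def)
  have J_ge: "J m \<le> J n" and K_le: "K n \<le> K m" if "n \<in> U" for n
    using that by (auto simp: U_def J_def K_def intro!: sum_mono)
  have eq_B: "?L n g = ?L m g" if "n \<in> U" "K n = K m" "g \<in> B" for n g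
    using sum_mono_inv[of "?L n" B "?L m" g] that AB(4) by (auto simp: K_def U_def)
  have outside: "?L n v = 0" if "n \<in> U" "v \<notin> E" for n v
    using U(2) that by (meson in_keys_iff subsetD)
  have tight0: "n = m" if n: "n \<in> U" "K n = K m" "J n = J m" for n
  proof (rule poly_mapping_eqI)
    fix v
    have "?L n f = ?L m f" if "f \<in> A" for f
      using sum_mono_inv[of "?L m" A "?L n" f] that n AB(3) by (auto simp: J_def U_def)
    moreover have "?L n e = ?L m e" using deg[OF n(1)] deg[OF mU(1)] n by simp
    ultimately show "?L n v = ?L m v"
      using eq_B[OF n(1,2)] outside[OF n(1)] outside[OF mU(1)] AB(5) by (cases "v \<in> E") auto
  qed
  \<comment> \<open>The excess of \<open>n\<close> over \<open>m\<close> on \<open>A\<close> is a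
    single unit at some \<open>f\<close>, and \<open>B\<close> is unchanged. The degree forces
    \<open>n(e) = m(e) - 1\<close>, so \<open>n\<close> is a forbidden exchange.\<close>
  have not_tight1: False if n: "n \<in> U" "K n = K m" "J n = Suc (J m)" for n
  proof -
    have "(\<Sum>f\<in>A. ?L n f - ?L m f) = J n - J m"
      unfolding J_def using n(1) by (intro sum_subtractf_nat) (auto simp: U_def)
    then have "(\<Sum>f\<in>A. ?L n f - ?L m f) = 1" using n(3) by simp
    then obtain f where f: "f \<in> A" "?L n f - ?L m f = 1" "\<forall>g\<in>A. f \<noteq> g \<longrightarrow> ?L n g - ?L m g = 0"
      unfolding sum_eq_1_iff[OF AB(3)] by blast
    have "?L m g \<le> ?L n g" if "g \<in> A" for g using n(1) that by (auto simp: U_def)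
    then have A_eq: "?L n f = Suc (?L m f)" "\<And>g. g \<in> A \<Longrightarrow> f \<noteq> g \<Longrightarrow> ?L n g = ?L m g"
      using f by (force simp: le_antisym)+
    have ne: "Suc (?L n e) = ?L m e" using deg[OF n(1)] deg[OF mU(1)] n by simp
    have "n = m - Poly_Mapping.single e 1 + Poly_Mapping.single f 1"
    proof (rule poly_mapping_eqI)
      fix v
      have "v = e \<or> v \<in> A \<or> v \<in> B \<or> v \<notin> E" using AB(5) by auto
      then show "?L n v = ?L (m - Poly_Mapping.single e 1 + Poly_Mapping.single f 1) v"
        using eq_B[OF n(1,2), of v] outside[OF n(1), of v] outside[OF mU(1), of v] A_eq ne f(1) AB(1,2,6-8) e(1)
        by (cases "v = f"; cases "v = e") (auto simp: lookup_add lookup_minus lookup_single)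
    qed
    moreover have "n \<in> T" "f \<in> E" "?L m f < ?L m' f" using n(1) f(1) by (auto simp: U_def A_def)
    ultimately show False using no_exchange by blast
  qed

  \<comment> \<open>The pair \<open>(D, N)\<close> is the direction of the edge leaving \<open>m\<close> in the Newton polygon of
    the exponent pairs \<open>(n(e), K n)\<close>; the terms with \<open>\<delta> n = 0\<close> are those on the edge.\<close>
  define slope :: "'e multi_index \<Rightarrow> real"
    where "slope n = real (K m - K n) / real (?L m e - ?L n e)" for n
  have "finite {n\<in>U. ?L n e < ?L m e}" "{n\<in>U. ?L n e < ?L m e} \<noteq> {}"
    using U(1) mU e(2) by auto
  then obtain n0 where n0: "n0 \<in> U" "?L n0 e < ?L m e"
    and slope_min: "\<And>n. n \<in> U \<Longrightarrow> ?L n e < ?L m e \<Longrightarrow> slope n0 \<le> slope n"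
    using ex_min_if_finite[of "slope ` {n\<in>U. ?L n e < ?L m e}"] by (fastforce simp: not_less)
  define D where "D = ?L m e - ?L n0 e"
  define N where "N = K m - K n0"
  have D: "D > 0" using n0 by (simp add: D_def)
  define \<delta> where "\<delta> n = int D * (int (K m) - int (K n)) - int N * (int (?L m e) - int (?L n e))" for n
  \<comment> \<open>If \<open>n(e) < m(e)\<close> this is minimality of the slope, cross-multiplied;
    otherwise both terms have the right sign.\<close>
  have \<delta>_nonneg: "\<delta> n \<ge> 0" if n: "n \<in> U" for n
  proof (cases "?L n e < ?L m e")
    case True
    then have "real N / real D \<le> real (K m - K n) / real (?L m e - ?L n e)"
      using slope_min[OF n] by (simp add: slope_def D_def N_def)
    then have "real N * real (?L m e - ?L n e) \<le> real D * real (K m - K n)"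
      using True D by (simp add: divide_simps mult_ac)
    then have "N * (?L m e - ?L n e) \<le> D * (K m - K n)"
      by (simp only: of_nat_mult[symmetric] of_nat_le_iff)
    then have "int N * int (?L m e - ?L n e) \<le> int D * int (K m - K n)"
      by (simp only: of_nat_mult[symmetric] of_nat_le_iff)
    then show ?thesis using True K_le[OF n] by (simp add: \<delta>_def of_nat_diff)
  next
    case False
    then have "int N * (int (?L m e) - int (?L n e)) \<le> 0" by (intro mult_nonneg_nonpos) auto
    moreover have "int D * (int (K m) - int (K n)) \<ge> 0" using K_le[OF n] by simp
    ultimately show ?thesis by (simp add: \<delta>_def)
  qed
  have \<delta>_n0: "\<delta> n0 = 0" using n0 K_le[OF n0(1)] by (simp add: \<delta>_def D_def N_def of_nat_diff)
  have J_diff: "int (J n) - int (J m) = (int (?L m e) - int (?L n e)) + (int (K m) - int (K n))"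
    if "n \<in> U" for n
    using deg[OF that] deg[OF mU(1)] by linarith

  \<comment> \<open>These edge terms share the power of \<open>y\<close> belonging to
    \<open>n0\<close>; \<open>l\<close> is chosen so that their sum does not cancel.\<close>
  define T0 where "T0 = {n\<in>U. J n = J n0 \<and> \<delta> n = 0}"
  have "finite T0" "T0 \<noteq> {}" "\<forall>n\<in>T0. Poly_Mapping.keys n \<subseteq> E" "\<forall>n\<in>T0. c n \<noteq> 0"
    using U c n0 \<delta>_n0 by (auto simp: T0_def)
  from exists_positive_nonzero[OF E this] obtain l
    where l: "\<And>v. l v > 0" and l_T0: "msum E T0 c (\<lambda>v. complex_of_real (l v)) \<noteq> 0" by blast
  define z where "z = (\<lambda>v. complex_of_real (l v))"
  \<comment> \<open>With these weights the power of \<open>\<tau>\<close> in the term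
    \<open>n\<close> is, by homogeneity, \<open>M + \<delta> n\<close>, with \<open>M\<close>
    independent of \<open>n\<close>.\<close>
  define w where "w v = (if v = e then N + D else if v \<in> A then D else 0)" for v
  define x where "x \<tau> y = (\<lambda>v. z v * of_real \<tau> ^ w v * (if v \<in> A then y else 1))" for \<tau> :: real and y
  define p where "p \<tau> = (\<Sum>n\<in>U. monom (c n * monom_eval E n z * of_real \<tau> ^ nat (\<delta> n)) (J n - J m))"
    for \<tau> :: real
  define M where "M = (N + D) * ?L m e + D * J m"

  have expo: "(N + D) * ?L n e + D * J n = M + nat (\<delta> n)" if n: "n \<in> U" for n
  proof -
    have J: "int (J n) = int (J m) + (int (?L m e) - int (?L n e)) + (int (K m) - int (K n))"
      using J_diff[OF n] by simp
    have "int ((N + D) * ?L n e + D * J n) = int M + \<delta> n"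
      unfolding M_def \<delta>_def of_nat_add of_nat_mult J by (simp add: algebra_simps)
    then show ?thesis using \<delta>_nonneg[OF n] by linarith
  qed
  have mono_x: "monom_eval E n (x \<tau> y)
      = of_real \<tau> ^ M * y ^ J m * (monom_eval E n z * of_real \<tau> ^ nat (\<delta> n) * y ^ (J n - J m))"
    if n: "n \<in> U" for n \<tau> y
  proof -
    have "(\<Prod>v\<in>E. (of_real \<tau> ^ w v) ^ ?L n v) = (of_real \<tau> :: complex) ^ (\<Sum>v\<in>E. w v * ?L n v)"
      by (simp add: power_sum power_mult)
    also have "(\<Sum>v\<in>E. w v * ?L n v) = (N + D) * ?L n e + D * J n"
    proof -
      have "(\<Sum>v\<in>A. w v * ?L n v) = D * J n"
        unfolding J_def sum_distrib_left using AB(7) by (intro sum.cong) (auto simp: w_def)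
      moreover have "(\<Sum>v\<in>B. w v * ?L n v) = 0"
        using AB(6,8) by (intro sum.neutral) (auto simp: w_def)
      ultimately show ?thesis unfolding split_E by (simp add: w_def)
    qed
    also have "\<dots> = M + nat (\<delta> n)" by (rule expo[OF n])
    finally have \<tau>: "(\<Prod>v\<in>E. (of_real \<tau> ^ w v) ^ ?L n v) = (of_real \<tau> :: complex) ^ (M + nat (\<delta> n))" .
    have "(\<Prod>v\<in>E. (if v \<in> A then y else 1) ^ ?L n v) = (\<Prod>v\<in>A. y ^ ?L n v)"
      using E AB(1) by (intro prod.mono_neutral_cong_right) auto
    also have "\<dots> = y ^ J n" by (simp add: J_def power_sum)
    also have "\<dots> = y ^ J m * y ^ (J n - J m)" using J_ge[OF n] by (simp flip: power_add)
    finally show ?thesis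
      using \<tau> by (simp add: monom_eval_def x_def power_mult_distrib prod.distrib power_add mult_ac)
  qed
  have msum_x: "msum E U c (x \<tau> y) = of_real \<tau> ^ M * y ^ J m * poly (p \<tau>) y" for \<tau> y
    unfolding msum_def p_def poly_sum sum_distrib_left
    by (intro sum.cong) (simp_all add: mono_x poly_monom)
  have real_roots: "y \<in> \<real>\<^sub>\<le>\<^sub>0" if "\<tau> > 0" "poly (p \<tau>) y = 0" for \<tau> y
  proof (rule ccontr)
    assume y: "y \<notin> \<real>\<^sub>\<le>\<^sub>0"
    have pos: "Re (csqrt y) > 0" using Re_csqrt_pos[OF y] .
    \<comment> \<open>Scaling by \<open>s\<close> turns the factors \<open>y\<close> on
      \<open>A\<close> and 1 elsewhere into \<open>csqrt y\<close> and its reciprocal, both in the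
      right half-plane; homogeneity carries nonvanishing back.\<close>
    define s where "s = 1 / csqrt y"
    have s: "Re s > 0" using pos by (auto simp: s_def Re_divide intro!: divide_pos_pos add_pos_nonneg)
    have "csqrt y \<noteq> 0" using pos by (metis less_irrefl zero_complex.simps(1))
    then have sy: "s * y = csqrt y"
      unfolding s_def by (subst (2) power2_csqrt[of y, symmetric]) (simp add: power2_eq_square)
    have "Re (s * x \<tau> y v) > 0" for v
    proof -
      have "s * x \<tau> y v = of_real (l v * \<tau> ^ w v) * (if v \<in> A then s * y else s)"
        by (simp add: x_def z_def)
      moreover have "l v * \<tau> ^ w v > 0" using l that(1) by simp
      moreover have "Re (if v \<in> A then s * y else s) > 0" using s pos sy by metis
      moreover have "Re (of_real t * q) = t * Re q" for t q by simp
      ultimately show ?thesis by (metis mult_pos_pos)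
    qed
    then have "msum E U c (\<lambda>v. s * x \<tau> y v) \<noteq> 0" by (intro hp) auto
    moreover have "msum E U c (\<lambda>v. s * x \<tau> y v) = s ^ r * msum E U c (x \<tau> y)"
      using homog by (intro msum_scale) (auto simp: U_def)
    ultimately show False using that(2) by (simp add: msum_x)
  qed

  have coeff_p: "coeff (p \<tau>) k
      = (\<Sum>n | n \<in> U \<and> J n = J m + k. c n * monom_eval E n z * of_real \<tau> ^ nat (\<delta> n))" for \<tau> k
  proof -
    have "J n - J m = k \<longleftrightarrow> J n = J m + k" if "n \<in> U" for n using J_ge[OF that] by auto
    then show ?thesis using U(1)
      by (simp add: p_def coeff_sum sum.inter_filter)
  qed
  have lim: "((\<lambda>\<tau>. coeff (p \<tau>) k) \<longlongrightarrow> coeff (p 0) k) (at_right 0)" for k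
  proof -
    have "isCont (\<lambda>\<tau>. coeff (p \<tau>) k) 0" unfolding coeff_p by (intro continuous_intros)
    then show ?thesis by (simp add: isCont_def filterlim_at_split)
  qed
  \<comment> \<open>Since \<open>0 ^ 0 = 1\<close>, exactly the edge terms survive at
    \<open>\<tau> = 0\<close>.\<close>
  have coeff_p0: "coeff (p 0) k = (\<Sum>n | n \<in> U \<and> J n = J m + k \<and> \<delta> n = 0. c n * monom_eval E n z)" for k
    unfolding coeff_p using U(1) \<delta>_nonneg
    by (intro sum.mono_neutral_cong_right) (auto simp: power_0_left intro: antisym)

  \<comment> \<open>With \<open>J n = J m\<close>, \<open>\<delta> n\<close> is \<open>D + N\<close>
    times the drop \<open>v\<close> in \<open>K\<close>, so \<open>v = 0\<close>.\<close>
  have "{n. n \<in> U \<and> J n = J m + 0 \<and> \<delta> n = 0} = {m}"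
  proof -
    have "n = m" if n: "n \<in> U" "J n = J m" "\<delta> n = 0" for n
    proof -
      define v where "v = int (K m) - int (K n)"
      have diff: "int (?L m e) - int (?L n e) = - v" using J_diff[OF n(1)] n(2) by (simp add: v_def)
      have "(int D + int N) * v = 0"
        using n(3) unfolding \<delta>_def v_def[symmetric] diff by (simp add: algebra_simps)
      then have "v = 0" using D by auto
      then show ?thesis using tight0 n by (simp add: v_def)
    qed
    then show ?thesis using mU by (auto simp: \<delta>_def)
  qed
  then have c0: "coeff (p 0) 0 \<noteq> 0"
    unfolding coeff_p0 using c mU(1) E l by (simp add: monom_eval_def z_def) (metis less_irrefl)
  \<comment> \<open>Here \<open>v = 0\<close> would be a forbidden exchange, and
    \<open>v \<ge> 1\<close> gives the two sides of the edge equation incompatible signs.\<close>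
  have "{n. n \<in> U \<and> J n = J m + 1 \<and> \<delta> n = 0} = {}"
  proof -
    have False if n: "n \<in> U" "J n = J m + 1" "\<delta> n = 0" for n
    proof -
      define v where "v = int (K m) - int (K n)"
      have diff: "int (?L m e) - int (?L n e) = 1 - v" using J_diff[OF n(1)] n(2) by (simp add: v_def)
      have *: "int D * v = int N * (1 - v)"
        using n(3) unfolding \<delta>_def v_def[symmetric] diff by simp
      have "v \<ge> 0" using K_le[OF n(1)] by (simp add: v_def)
      moreover have "v \<noteq> 0" using not_tight1[OF n(1)] n(2) by (auto simp: v_def)
      ultimately have "v \<ge> 1" by simp
      then have "int D * v > 0" "int N * (1 - v) \<le> 0" using D by (auto intro: mult_nonneg_nonpos)
      then show False using * by simp
    qed
    then show ?thesis by blast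
  qed
  then have c1: "coeff (p 0) 1 = 0" unfolding coeff_p0 by (simp only: sum.empty)
  have "J n0 = J m + (D + N)"
    using J_diff[OF n0(1)] n0(2) K_le[OF n0(1)] by (simp add: D_def N_def)
  moreover obtain k where k: "D + N = Suc k" using D by (cases "D + N") auto
  ultimately have "coeff (p 0) (Suc k) = msum E T0 c z"
    unfolding coeff_p0 by (simp add: T0_def msum_def)
  then have ck: "coeff (p 0) (Suc k) \<noteq> 0" using l_T0 by (simp add: z_def)

  \<comment> \<open>Real-rootedness is known only for \<open>\<tau> > 0\<close>, so the coefficient
    bound is passed to the limit.\<close>
  have "norm (coeff (p 0) (Suc k)) * norm (coeff (p 0) 0) ^ k \<le> norm (coeff (p 0) 1) ^ Suc k"
  proof (rule tendsto_le)
    show "((\<lambda>\<tau>. norm (coeff (p \<tau>) 1) ^ Suc k) \<longlongrightarrow> norm (coeff (p 0) 1) ^ Suc k) (at_right 0)"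
      by (intro tendsto_intros lim)
    show "((\<lambda>\<tau>. norm (coeff (p \<tau>) (Suc k)) * norm (coeff (p \<tau>) 0) ^ k) \<longlongrightarrow>
        norm (coeff (p 0) (Suc k)) * norm (coeff (p 0) 0) ^ k) (at_right 0)"
      by (intro tendsto_intros lim)
    have "\<forall>\<^sub>F \<tau> in at_right 0. coeff (p \<tau>) 0 \<noteq> 0"
      using tendsto_imp_eventually_ne[OF lim c0] .
    moreover have "\<forall>\<^sub>F \<tau> in at_right 0. \<tau> > (0::real)" by (rule eventually_at_right_less)
    ultimately show "\<forall>\<^sub>F \<tau> in at_right 0.
        norm (coeff (p \<tau>) (Suc k)) * norm (coeff (p \<tau>) 0) ^ k \<le> norm (coeff (p \<tau>) 1) ^ Suc k"
      by eventually_elim (rule coeff_bound_nonpos_real_roots, auto intro: real_roots)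
  qed auto
  moreover have "norm (coeff (p 0) (Suc k)) * norm (coeff (p 0) 0) ^ k > 0" using c0 ck by simp
  ultimately show False using c1 by simp
qed

theorem theorem7p2:
  fixes E :: "'e set" and P :: "'e cpoly" and r :: nat
  assumes "finite E"
    and "poly_in E P"
    and "homogeneous_of_degree E r P"
    and "half_plane_property E P"
    and "P \<noteq> 0"
  shows "\<forall>m\<in>supp P. \<forall>m'\<in>supp P. \<forall>e\<in>E.
           Poly_Mapping.lookup m e > Poly_Mapping.lookup m' e \<longrightarrow>
           (\<exists>f\<in>E. Poly_Mapping.lookup m f < Poly_Mapping.lookup m' f \<and>
              m - Poly_Mapping.single e 1 + Poly_Mapping.single f 1 \<in> supp P)"
proof -
  have "supp P = Poly_Mapping.keys P" by (auto simp: supp_def in_keys_iff)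
  then have "hp_support E (supp P)"
    using assms unfolding hp_support_def half_plane_property_def poly_in_def
    by (auto simp: supp_def[of P] poly_eval_def msum_def intro!: exI[of _ "Poly_Mapping.lookup P"])
  then show ?thesis
    using hp_support_exchange[OF assms(1)] assms(3) unfolding homogeneous_of_degree_def by blast
qed

end
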